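(* For every $m \in \mathbb{Z}$, $$\Delta^{(m)}(t)=\exp\left(\sum_{n=1}^\infty\frac{[mn]_q}{n}\nabla^{(0)}_nt^n\right),$$ where the exponential power series is computed with respect to the $q$-shuffle product $\star$.
   Context: Let $\mathbb{F}$ be a field of characteristic zero and let $q \in \mathbb{F}$ be nonzero and not a root of unity. $\mathbb{N}=\{0,1,2,\ldots\}$. For $n \in \mathbb{Z}$, $[n]_q=\frac{q^n-q^{-n}}{q-q^{-1}}$. $\mathbb{V}$ is the free associative unital $\mathbb{F}$-algebra on noncommuting letters $x,y$; the words (products of letters, including the empty word $\mathbf{1}$) form a basis, and juxtaposition denotes the free product. The $q$-shuffle product $\star$ is the associative bilinear product on $\mathbb{V}$ determined by $\mathbf{1}\star v=v\star\mathbf{1}=v$ and, for nonempty words $u=u_1\cdots u_r$, $v=v_1\cdots v_s$, $$u \star v=u_1((u_2 \cdots u_r) \star v)+v_1(u \star (v_2 \cdots v_s))\,q^{\langle v_1,u_1 \rangle+\cdots+\langle v_1,u_r \rangle},$$ where $\langle x,x\rangle=\langle y,y\rangle=2$ and $\langle x,y\rangle=\langle y,x\rangle=-2$. It extends to formal power series in the (central) indeterminate $t$ with coefficients in $\mathbb{V}$. Set $\overline{x}=1$, $\overline{y}=-1$. A word $a_1\cdots a_n$ is Catalan if $\overline{a}_1+\cdots+\overline{a}_i\geq 0$ for $1\leq i\leq n-1$ and $\overline{a}_1+\cdots+\overline{a}_n=0$ (the empty word is Catalan; Catalan words have even length). $\mathrm{Cat}_n$ is the set of Catalan words of length $2n$.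 For $m\in\mathbb{Z}$ and a Catalan word $w=a_1\cdots a_{2n}$: $\Delta^{(m)}(w)=\prod_{i=1}^{2n}[\overline{a}_1+\cdots+\overline{a}_{i-1}+m(\overline{a}_i+1)/2]_q$ (equal to $1$ if $w=\mathbf{1}$), and, if $n\geq 1$, $\nabla^{(m)}(w)=\prod_{i=2}^{2n}[\overline{a}_1+\cdots+\overline{a}_{i-1}+m(\overline{a}_i+1)/2]_q$. Define $\Delta^{(m)}_n=\sum_{w\in\mathrm{Cat}_n}\Delta^{(m)}(w)w$ for $n\in\mathbb{N}$ and $\nabla^{(m)}_n=\sum_{w\in\mathrm{Cat}_n}\nabla^{(m)}(w)w$ for $n\geq 1$. Set $\Delta^{(m)}(t)=\sum_{n\in\mathbb{N}}\Delta^{(m)}_nt^n$. $\exp(z)=\sum_{n\in\mathbb{N}} z^n/n!$. *)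

theory Defs
  imports
    "HOL-Library.Poly_Mapping"
    "HOL-Computational_Algebra.Formal_Power_Series"
begin

definition q_int :: "'a::field \<Rightarrow> int \<Rightarrow> 'a" where
  "q_int q n = (q powi n - q powi (- n)) / (q - inverse q)"

datatype letter = X | Y

type_synonym word = "letter list"

text \<open>The free algebra \<open>\<bbbV>\<close>: finitely supported coefficient functions on words.\<close>

type_synonym 'a free_alg = "word \<Rightarrow>\<^sub>0 'a"

definition scal :: "'a::field \<Rightarrow> 'a free_alg \<Rightarrow> 'a free_alg" where
  "scal c p = Poly_Mapping.map ((*) c) p"

text \<open>The bilinear map on \<open>\<bbbV>\<close> with prescribed values on pairs of basis words.\<close>

definition bilinear_ext ::
  "(word \<Rightarrow> word \<Rightarrow> 'a free_alg) \<Rightarrow> 'a::field free_alg \<Rightarrow> 'a free_alg \<Rightarrow> 'a free_alg" where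
  "bilinear_ext b f g =
     (\<Sum>u\<in>Poly_Mapping.keys f. \<Sum>v\<in>Poly_Mapping.keys g.
        scal (Poly_Mapping.lookup f u * Poly_Mapping.lookup g v) (b u v))"

definition free_mult :: "'a::field free_alg \<Rightarrow> 'a free_alg \<Rightarrow> 'a free_alg" where
  "free_mult = bilinear_ext (\<lambda>u v. Poly_Mapping.single (u @ v) 1)"

definition letter_mult :: "letter \<Rightarrow> 'a::field free_alg \<Rightarrow> 'a free_alg" where
  "letter_mult a p = free_mult (Poly_Mapping.single [a] 1) p"

definition pairing :: "letter \<Rightarrow> letter \<Rightarrow> int" where
  "pairing a b = (if a = b then 2 else - 2)"

fun q_shuffle_word :: "'a::field \<Rightarrow> word \<Rightarrow> word \<Rightarrow> 'a free_alg" where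
  "q_shuffle_word q [] v = Poly_Mapping.single v 1"
| "q_shuffle_word q u [] = Poly_Mapping.single u 1"
| "q_shuffle_word q (a # u) (b # v) =
     letter_mult a (q_shuffle_word q u (b # v)) +
     scal (q powi (\<Sum>c\<leftarrow>a # u. pairing b c)) (letter_mult b (q_shuffle_word q (a # u) v))"

definition q_shuffle :: "'a::field \<Rightarrow> 'a free_alg \<Rightarrow> 'a free_alg \<Rightarrow> 'a free_alg" where
  "q_shuffle q = bilinear_ext (q_shuffle_word q)"

text \<open>
  Power series in \<open>t\<close> over \<open>\<bbbV>\<close>. The type \<open>fps\<close> serves as a container only: the ring
  structure on the coefficients depends on \<open>q\<close>, so the product cannot come from a type class.
\<close>

definition q_shuffle_fps ::
  "'a::field \<Rightarrow> 'a free_alg fps \<Rightarrow> 'a free_alg fps \<Rightarrow> 'a free_alg fps" where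
  "q_shuffle_fps q f g =
     Abs_fps (\<lambda>n. \<Sum>i\<le>n. q_shuffle q (fps_nth f i) (fps_nth g (n - i)))"

primrec q_shuffle_power :: "'a::field \<Rightarrow> 'a free_alg fps \<Rightarrow> nat \<Rightarrow> 'a free_alg fps" where
  "q_shuffle_power q f 0 = Abs_fps (\<lambda>n. if n = 0 then Poly_Mapping.single [] 1 else 0)"
| "q_shuffle_power q f (Suc k) = q_shuffle_fps q f (q_shuffle_power q f k)"

text \<open>
  \<open>Sum_any\<close> is the sum of a family with finite support. Each coefficient of the exponential
  is such a sum when the constant term of \<open>f\<close> vanishes (\<open>q_shuffle_exp_nth\<close> below); for other
  \<open>f\<close> the value is meaningless.
\<close>

definition q_shuffle_exp :: "'a::field_char_0 \<Rightarrow> 'a free_alg fps \<Rightarrow> 'a free_alg fps" where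
  "q_shuffle_exp q f =
     Abs_fps (\<lambda>n. Sum_any (\<lambda>k. scal (1 / fact k) (fps_nth (q_shuffle_power q f k) n)))"

lemma q_shuffle_power_nth_eq_0:
  assumes "fps_nth f 0 = 0" and "n < k"
  shows "fps_nth (q_shuffle_power q f k) n = 0"
  using assms(2)
proof (induction k arbitrary: n)
  case 0
  then show ?case by simp
next
  case (Suc k)
  have "q_shuffle q (fps_nth f i) (fps_nth (q_shuffle_power q f k) (n - i)) = 0"
    if "i \<le> n" for i
  proof (cases "i = 0")
    case True
    then show ?thesis using assms(1) by (simp add: q_shuffle_def bilinear_ext_def)
  next
    case False
    then have "n - i < k" using Suc.prems that by linarith
    then show ?thesis using Suc.IH by (simp add: q_shuffle_def bilinear_ext_def)
  qed
  then show ?case by (simp add: q_shuffle_fps_def)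
qed

lemma q_shuffle_exp_nth:
  assumes "fps_nth f 0 = 0"
  shows "fps_nth (q_shuffle_exp q f) n =
    (\<Sum>k\<le>n. scal (1 / fact k) (fps_nth (q_shuffle_power q f k) n))"
proof -
  have "scal c 0 = 0" for c :: 'a
    unfolding scal_def by (rule poly_mapping_eqI) (simp add: Poly_Mapping.map.rep_eq when_def)
  then have "{k. scal (1 / fact k) (fps_nth (q_shuffle_power q f k) n) \<noteq> 0} \<subseteq> {..n}"
    using q_shuffle_power_nth_eq_0[OF assms] by (force simp: not_le[symmetric])
  then show ?thesis
    by (simp add: q_shuffle_exp_def Sum_any.expand_superset)
qed

fun bar :: "letter \<Rightarrow> int" where
  "bar X = 1"
| "bar Y = - 1"

definition height :: "word \<Rightarrow> int" where
  "height w = (\<Sum>a\<leftarrow>w. bar a)"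

definition catalan :: "word \<Rightarrow> bool" where
  "catalan w \<longleftrightarrow> (\<forall>i\<in>{1..length w - 1}. 0 \<le> height (take i w)) \<and> height w = 0"

definition Cat :: "nat \<Rightarrow> word set" where
  "Cat n = {w. catalan w \<and> length w = 2 * n}"

text \<open>
  Letters are indexed from \<open>0\<close>, so the factor at index \<open>i\<close> belongs to the \<open>(i+1)\<close>-st letter.
  The division is exact.
\<close>

definition q_factor :: "'a::field \<Rightarrow> int \<Rightarrow> word \<Rightarrow> nat \<Rightarrow> 'a" where
  "q_factor q m w i = q_int q (height (take i w) + m * ((bar (w ! i) + 1) div 2))"

definition Delta_word :: "'a::field \<Rightarrow> int \<Rightarrow> word \<Rightarrow> 'a" where
  "Delta_word q m w = (\<Prod>i\<in>{0..<length w}. q_factor q m w i)"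

definition nabla_word :: "'a::field \<Rightarrow> int \<Rightarrow> word \<Rightarrow> 'a" where
  "nabla_word q m w = (\<Prod>i\<in>{1..<length w}. q_factor q m w i)"

definition Delta :: "'a::field \<Rightarrow> int \<Rightarrow> nat \<Rightarrow> 'a free_alg" where
  "Delta q m n = (\<Sum>w\<in>Cat n. Poly_Mapping.single w (Delta_word q m w))"

text \<open>Only meant for \<open>n \<ge> 1\<close>.\<close>

definition nabla :: "'a::field \<Rightarrow> int \<Rightarrow> nat \<Rightarrow> 'a free_alg" where
  "nabla q m n = (\<Sum>w\<in>Cat n. Poly_Mapping.single w (nabla_word q m w))"

definition Delta_fps :: "'a::field \<Rightarrow> int \<Rightarrow> 'a free_alg fps" where
  "Delta_fps q m = Abs_fps (Delta q m)"

end

theory Submission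
  imports Defs "HOL-Computational_Algebra.Polynomial"
begin

text \<open>
  A word of a Catalan series in degree \<open>n\<close> has length \<open>2 n\<close>, so the variable \<open>t\<close> can be dropped and
  the series becomes one function on words. Its value at a word is a vacuum matrix coefficient: it is
  read off a lattice path with weighted steps, and the \<open>q\<close>-shuffle product corresponds to a tensor
  product of modules. An explicit vector in such a tensor product gives the factorisation
  \<open>\<Delta>\<^sup>(\<^sup>m\<^sup>)(t) = A(q\<^sup>m t) \<star> B(q\<^sup>-\<^sup>m t)\<close> with \<open>A \<star> B = \<one>\<close>. Reversing a word and exchanging the letters
  is an antiautomorphism of the \<open>q\<close>-shuffle algebra fixing these series, so the factors may be
  swapped, and comparing coefficients in the scaling parameter shows that all coefficients of \<open>A\<close> and
  \<open>B\<close> commute. Differentiating the factorisation in the scaling parameter at its trivial value identifies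
  \<open>t A'(t) \<star> B(t)\<close> with \<open>\<nabla>\<^sup>(\<^sup>0\<^sup>)(t) / (q - q\<^sup>-\<^sup>1)\<close>. Hence \<open>\<Delta>\<^sup>(\<^sup>m\<^sup>)(t)\<close> satisfies the first order
  differential equation that characterises the exponential.
\<close>

section \<open>Shuffle coefficients and the convolution of functions on words\<close>

definition letter_weight :: "'a::field \<Rightarrow> letter \<Rightarrow> word \<Rightarrow> 'a" where
  "letter_weight q a u = q powi (\<Sum>c\<leftarrow>u. pairing a c)"

text \<open>
  The sum of \<open>F u v\<close> over all ways to split \<open>w\<close> into complementary subwords \<open>u\<close> and \<open>v\<close>, with the
  power of \<open>q\<close> with which \<open>w\<close> then occurs in \<open>u \<star> v\<close>.
\<close>

primrec shuffle_sum :: "'a::field \<Rightarrow> word \<Rightarrow> (word \<Rightarrow> word \<Rightarrow> 'a) \<Rightarrow> 'a" where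
  "shuffle_sum q [] F = F [] []"
| "shuffle_sum q (a # w) F =
     shuffle_sum q w (\<lambda>u v. F (a # u) v) +
     shuffle_sum q w (\<lambda>u v. letter_weight q a u * F u (a # v))"

definition conv :: "'a::field \<Rightarrow> (word \<Rightarrow> 'a) \<Rightarrow> (word \<Rightarrow> 'a) \<Rightarrow> word \<Rightarrow> 'a" where
  "conv q f g w = shuffle_sum q w (\<lambda>u v. f u * g v)"

definition counit :: "word \<Rightarrow> 'a::field" where
  "counit w = (if w = [] then 1 else 0)"

abbreviation num_Y :: "word \<Rightarrow> nat" where
  "num_Y w \<equiv> count_list w Y"

lemma height_simps [simp]:
  "height [] = 0" "height (a # w) = bar a + height w" "height (u @ v) = height u + height v"
  by (simp_all add: height_def)

lemma length_eq_height: "int (length w) = height w + 2 * int (num_Y w)"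
proof (induction w)
  case (Cons a w) then show ?case by (cases a) auto
qed simp

text \<open>Only complementary subwords of \<open>w\<close> enter the sum, so \<open>F\<close> and
  \<open>G\<close> need to agree only where the additive statistics of \<open>u\<close> and
  \<open>v\<close> add up to those of \<open>w\<close>.\<close>

lemma shuffle_sum_cong:
  assumes "\<And>u v. height u + height v = height w \<Longrightarrow> num_Y u + num_Y v = num_Y w \<Longrightarrow>
             length u + length v = length w \<Longrightarrow> F u v = G u v"
  shows "shuffle_sum q w F = shuffle_sum q w G"
  using assms
proof (induction w arbitrary: F G)
  case (Cons a w)
  have "shuffle_sum q w (\<lambda>u v. F (a # u) v) = shuffle_sum q w (\<lambda>u v. G (a # u) v)"
    by (rule Cons.IH, rule Cons.prems) auto
  moreover have "shuffle_sum q w (\<lambda>u v. letter_weight q a u * F u (a # v)) =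
      shuffle_sum q w (\<lambda>u v. letter_weight q a u * G u (a # v))"
  proof (rule Cons.IH)
    fix u v assume "height u + height v = height w" "num_Y u + num_Y v = num_Y w"
      "length u + length v = length w"
    then have "F u (a # v) = G u (a # v)" by (intro Cons.prems) auto
    then show "letter_weight q a u * F u (a # v) = letter_weight q a u * G u (a # v)" by simp
  qed
  ultimately show ?case by simp
qed simp

lemma shuffle_sum_0 [simp]: "shuffle_sum q w (\<lambda>u v. 0) = 0"
  by (induction w) auto

lemma shuffle_sum_add:
  "shuffle_sum q w (\<lambda>u v. F u v + G u v) = shuffle_sum q w F + shuffle_sum q w G"
  by (induction w arbitrary: F G) (auto simp: algebra_simps)

lemma shuffle_sum_mult:
  "shuffle_sum q w (\<lambda>u v. c * F u v) = c * shuffle_sum q w F"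
proof (induction w arbitrary: F)
  case (Cons a w)
  show ?case
    using Cons.IH[of "\<lambda>u v. F (a # u) v"] Cons.IH[of "\<lambda>u v. letter_weight q a u * F u (a # v)"]
    by (simp add: algebra_simps)
qed simp

lemma shuffle_sum_sum:
  "shuffle_sum q w (\<lambda>u v. \<Sum>i\<in>I. F i u v) = (\<Sum>i\<in>I. shuffle_sum q w (F i))"
  by (induction I rule: infinite_finite_induct) (simp_all add: shuffle_sum_add)

lemma letter_weight_Nil [simp]: "letter_weight q a [] = 1"
  by (simp add: letter_weight_def)

lemma letter_weight_append:
  "q \<noteq> 0 \<Longrightarrow> letter_weight q a (u @ v) = letter_weight q a u * letter_weight q a v"
  by (simp add: letter_weight_def power_int_add)

lemma letter_weight_Cons:
  "q \<noteq> 0 \<Longrightarrow> letter_weight q a (b # v) = q powi pairing a b * letter_weight q a v"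
  by (simp add: letter_weight_def power_int_add)

lemma pairing_commute: "pairing a b = pairing b a"
  by (auto simp: pairing_def)

lemma letter_weight_eq_height: "letter_weight q a u = q powi (2 * bar a * height u)"
proof -
  have "(\<Sum>c\<leftarrow>u. pairing a c) = 2 * bar a * height u"
  proof (induction u)
    case (Cons b u)
    then show ?case by (cases a; cases b) (auto simp: pairing_def)
  qed simp
  then show ?thesis by (simp add: letter_weight_def)
qed

lemma letter_weight_height_add:
  assumes "q \<noteq> 0" and "height u + height v = height w"
  shows "letter_weight q a w = letter_weight q a u * letter_weight q a v"
  using assms by (simp add: letter_weight_eq_height power_int_add[symmetric] distrib_left[symmetric])

text \<open>Both sides run over the splittings of \<open>w\<close> into three subwords. A first
  letter sent to the third one crosses \<open>u\<close> on the left and \<open>s\<close> and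
  \<open>t\<close> on the right; the weights agree because \<open>letter_weight\<close> depends on
  the height alone, which is additive.\<close>

lemma shuffle_sum_assoc:
  assumes "q \<noteq> 0"
  shows "shuffle_sum q w (\<lambda>u v. shuffle_sum q u (\<lambda>s t. H s t v)) =
         shuffle_sum q w (\<lambda>s v. shuffle_sum q v (\<lambda>t r. H s t r))"
proof (induction w arbitrary: H)
  case (Cons a w)
  have 1: "shuffle_sum q w (\<lambda>u v. letter_weight q a u * shuffle_sum q u (\<lambda>s t. H s t (a # v))) =
      shuffle_sum q w (\<lambda>u v. shuffle_sum q u
        (\<lambda>s t. letter_weight q a s * letter_weight q a t * H s t (a # v)))"
  proof (rule shuffle_sum_cong)
    fix u v
    show "letter_weight q a u * shuffle_sum q u (\<lambda>s t. H s t (a # v)) =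
      shuffle_sum q u (\<lambda>s t. letter_weight q a s * letter_weight q a t * H s t (a # v))"
      unfolding shuffle_sum_mult[symmetric]
      by (rule shuffle_sum_cong) (simp add: letter_weight_height_add[OF assms])
  qed
  have "shuffle_sum q (a # w) (\<lambda>u v. shuffle_sum q u (\<lambda>s t. H s t v)) =
      shuffle_sum q w (\<lambda>s v. shuffle_sum q v (\<lambda>t r. H (a # s) t r)) +
      shuffle_sum q w (\<lambda>s v. shuffle_sum q v (\<lambda>t r. letter_weight q a s * H s (a # t) r)) +
      shuffle_sum q w (\<lambda>s v. shuffle_sum q v
        (\<lambda>t r. letter_weight q a s * letter_weight q a t * H s t (a # r)))"
    using Cons.IH[of "\<lambda>s t v. H (a # s) t v"]
      Cons.IH[of "\<lambda>s t v. letter_weight q a s * H s (a # t) v"]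
      Cons.IH[of "\<lambda>s t r. letter_weight q a s * letter_weight q a t * H s t (a # r)"] 1
    by (simp add: shuffle_sum_add)
  also have "\<dots> = shuffle_sum q (a # w) (\<lambda>s v. shuffle_sum q v (\<lambda>t r. H s t r))"
    by (simp add: shuffle_sum_add distrib_left mult.assoc shuffle_sum_mult)
  finally show ?case .
qed simp

text \<open>A power of \<open>q\<close> arises from each pair in which a letter of \<open>v\<close>
  precedes a letter of \<open>u\<close>. A last letter placed in \<open>u\<close> forms such a pair
  with every letter of \<open>v\<close>, and \<open>pairing\<close> is symmetric.\<close>

lemma shuffle_sum_snoc:
  assumes "q \<noteq> 0"
  shows "shuffle_sum q (w @ [a]) F =
     shuffle_sum q w (\<lambda>u v. F u (v @ [a])) +
     shuffle_sum q w (\<lambda>u v. letter_weight q a v * F (u @ [a]) v)"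
proof (induction w arbitrary: F)
  case (Cons b w)
  show ?case
    by (simp add: Cons.IH letter_weight_append letter_weight_Cons assms
        pairing_commute[of b a] mult_ac)
next
  case Nil show ?case by simp
qed

fun swap_letter :: "letter \<Rightarrow> letter" where
  "swap_letter X = Y"
| "swap_letter Y = X"

definition zeta :: "word \<Rightarrow> word" where
  "zeta w = rev (map swap_letter w)"

lemma zeta_simps [simp]: "zeta [] = []" "zeta (a # w) = zeta w @ [swap_letter a]"
  by (simp_all add: zeta_def)

lemma letter_weight_zeta: "letter_weight q (swap_letter a) (zeta u) = letter_weight q a u"
proof -
  have "height (zeta u) = - height u"
  proof (induction u)
    case (Cons b u) then show ?case by (cases b) auto
  qed simp
  then show ?thesis by (cases a) (simp_all add: letter_weight_eq_height)
qed

text \<open>Reversing the word and exchanging the two subwords preserves the pairs in which a letter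
  of the second precedes one of the first; swapping X and Y preserves
  \<open>pairing\<close>.\<close>

lemma shuffle_sum_zeta:
  assumes "q \<noteq> 0"
  shows "shuffle_sum q (zeta w) F = shuffle_sum q w (\<lambda>u v. F (zeta v) (zeta u))"
proof (induction w arbitrary: F)
  case (Cons a w)
  show ?case
    by (simp add: shuffle_sum_snoc[OF assms] Cons.IH letter_weight_zeta)
qed simp

lemma conv_assoc:
  assumes "q \<noteq> 0"
  shows "conv q (conv q f g) h = conv q f (conv q g h)"
proof
  fix w
  show "conv q (conv q f g) h w = conv q f (conv q g h) w"
    using shuffle_sum_assoc[OF assms, of w "\<lambda>s t v. f s * g t * h v"]
    by (simp add: conv_def shuffle_sum_mult[symmetric] mult.commute[of _ "h _"])
       (simp add: mult_ac)
qed

lemma shuffle_sum_Nil_left: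
  assumes "\<And>u v. u \<noteq> [] \<Longrightarrow> F u v = 0"
  shows "shuffle_sum q w F = F [] w"
  using assms
proof (induction w arbitrary: F)
  case (Cons a w)
  have "shuffle_sum q w (\<lambda>u v. letter_weight q a u * F u (a # v)) = F [] (a # w)"
    by (subst Cons.IH) (auto simp: Cons.prems)
  then show ?case by (simp add: Cons.prems)
qed simp

lemma shuffle_sum_Nil_right:
  assumes "\<And>u v. v \<noteq> [] \<Longrightarrow> F u v = 0"
  shows "shuffle_sum q w F = F w []"
  using assms
proof (induction w arbitrary: F)
  case (Cons a w)
  have "shuffle_sum q w (\<lambda>u v. F (a # u) v) = F (a # w) []"
    by (subst Cons.IH) (auto simp: Cons.prems)
  then show ?case by (simp add: Cons.prems)
qed simp

lemma conv_counit_left [simp]: "conv q counit f = f"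
  by (rule ext) (simp add: conv_def counit_def shuffle_sum_Nil_left)

lemma conv_counit_right [simp]: "conv q f counit = f"
  by (rule ext) (simp add: conv_def counit_def shuffle_sum_Nil_right)

lemma conv_zeta:
  assumes "q \<noteq> 0"
  shows "conv q f g (zeta w) = conv q (\<lambda>v. g (zeta v)) (\<lambda>u. f (zeta u)) w"
  by (simp add: conv_def shuffle_sum_zeta[OF assms] mult.commute)

lemma conv_sum_left: "conv q (\<lambda>u. \<Sum>i\<in>I. f i u) g w = (\<Sum>i\<in>I. conv q (f i) g w)"
  by (simp add: conv_def sum_distrib_right shuffle_sum_sum)

lemma conv_sum_right: "conv q f (\<lambda>u. \<Sum>i\<in>I. g i u) w = (\<Sum>i\<in>I. conv q f (g i) w)"
  by (simp add: conv_def sum_distrib_left shuffle_sum_sum)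

lemma conv_mult_left: "conv q (\<lambda>u. c * f u) g w = c * conv q f g w"
  by (simp add: conv_def shuffle_sum_mult[symmetric] mult.assoc)

lemma conv_mult_right: "conv q f (\<lambda>u. c * g u) w = c * conv q f g w"
  by (simp add: conv_def shuffle_sum_mult[symmetric] mult_ac)

lemma conv_cong:
  assumes "\<And>u v. height u + height v = height w \<Longrightarrow> num_Y u + num_Y v = num_Y w \<Longrightarrow>
             length u + length v = length w \<Longrightarrow> f u * g v = f' u * g' v"
  shows "conv q f g w = conv q f' g' w"
  unfolding conv_def by (rule shuffle_sum_cong) (rule assms)

section \<open>The grading by the number of letters Y\<close>

text \<open>
  On Catalan words the number of letters \<open>Y\<close> is the exponent of \<open>t\<close>: \<open>dilate z\<close> is the
  substitution of \<open>z t\<close> for \<open>t\<close> and \<open>euler\<close> is \<open>t d/dt\<close>.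
\<close>

definition scale_by :: "(nat \<Rightarrow> 'a::field) \<Rightarrow> (word \<Rightarrow> 'a) \<Rightarrow> word \<Rightarrow> 'a" where
  "scale_by c f w = c (num_Y w) * f w"

abbreviation dilate :: "'a::field \<Rightarrow> (word \<Rightarrow> 'a) \<Rightarrow> word \<Rightarrow> 'a" where
  "dilate z \<equiv> scale_by (\<lambda>n. z ^ n)"

abbreviation euler :: "(word \<Rightarrow> 'a::field) \<Rightarrow> word \<Rightarrow> 'a" where
  "euler \<equiv> scale_by of_nat"

abbreviation hom_part :: "nat \<Rightarrow> (word \<Rightarrow> 'a::field) \<Rightarrow> word \<Rightarrow> 'a" where
  "hom_part i \<equiv> scale_by (\<lambda>n. if n = i then 1 else 0)"

lemma scale_by_scale_by: "scale_by c (scale_by d f) = scale_by (\<lambda>n. c n * d n) f"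
  by (simp add: scale_by_def fun_eq_iff)

lemma dilate_conv: "dilate z (conv q f g) = conv q (dilate z f) (dilate z g)"
  by (rule ext, simp add: scale_by_def conv_def shuffle_sum_mult[symmetric], rule shuffle_sum_cong)
     (auto simp: power_add[symmetric] mult_ac)

lemma euler_conv: "euler (conv q f g) w = conv q (euler f) g w + conv q f (euler g) w"
proof -
  have "euler (conv q f g) w = shuffle_sum q w (\<lambda>u v. of_nat (num_Y w) * (f u * g v))"
    by (simp only: shuffle_sum_mult) (simp add: scale_by_def conv_def)
  also have "\<dots> = shuffle_sum q w (\<lambda>u v. euler f u * g v + f u * euler g v)"
  proof (rule shuffle_sum_cong)
    fix u v assume "num_Y u + num_Y v = num_Y w"
    from this[symmetric] show "of_nat (num_Y w) * (f u * g v) = euler f u * g v + f u * euler g v"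
      by (simp add: scale_by_def algebra_simps)
  qed
  finally show ?thesis by (simp add: shuffle_sum_add conv_def)
qed

lemma conv_eq_sum_hom_part_left:
  "conv q f g w = (\<Sum>i\<le>num_Y w. conv q (hom_part i f) g w)"
proof -
  have "conv q f g w = shuffle_sum q w (\<lambda>u v. \<Sum>i\<le>num_Y w. hom_part i f u * g v)"
    unfolding conv_def
  proof (rule shuffle_sum_cong)
    fix u v assume Y: "num_Y u + num_Y v = num_Y w"
    have "(\<Sum>i\<le>num_Y w. hom_part i f u * g v) =
        (\<Sum>i\<le>num_Y w. if i = num_Y u then f u * g v else 0)"
      by (rule sum.cong) (auto simp: scale_by_def)
    then show "f u * g v = (\<Sum>i\<le>num_Y w. hom_part i f u * g v)"
      using Y by auto
  qed
  then show ?thesis by (simp add: shuffle_sum_sum conv_def)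
qed

lemma conv_eq_sum_hom_part_right:
  "conv q f g w = (\<Sum>i\<le>num_Y w. conv q f (hom_part i g) w)"
proof -
  have "conv q f g w = shuffle_sum q w (\<lambda>u v. \<Sum>i\<le>num_Y w. f u * hom_part i g v)"
    unfolding conv_def
  proof (rule shuffle_sum_cong)
    fix u v assume Y: "num_Y u + num_Y v = num_Y w"
    have "(\<Sum>i\<le>num_Y w. f u * hom_part i g v) =
        (\<Sum>i\<le>num_Y w. if i = num_Y v then f u * g v else 0)"
      by (rule sum.cong) (auto simp: scale_by_def)
    then show "f u * g v = (\<Sum>i\<le>num_Y w. f u * hom_part i g v)"
      using Y by auto
  qed
  then show ?thesis by (simp add: shuffle_sum_sum conv_def)
qed

text \<open>Degrees add, so once one factor is confined to degree \<open>i\<close>, confining the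
  other to degree \<open>j\<close> amounts to confining \<open>w\<close> to degree
  \<open>i + j\<close>.\<close>

lemma conv_hom_part_hom_part:
  "conv q (hom_part i f) (hom_part j g) w =
     (if num_Y w = i + j then conv q (hom_part i f) g w else 0)"
proof -
  have "conv q (hom_part i f) (hom_part j g) w =
      shuffle_sum q w (\<lambda>u v. (if num_Y w = i + j then 1 else 0) * (hom_part i f u * g v))"
    unfolding conv_def by (rule shuffle_sum_cong) (auto simp: scale_by_def)
  then show ?thesis by (simp only: shuffle_sum_mult) (simp add: conv_def)
qed

lemma conv_hom_part_hom_part':
  "conv q (hom_part j g) (hom_part i f) w =
     (if num_Y w = i + j then conv q g (hom_part i f) w else 0)"
proof -
  have "conv q (hom_part j g) (hom_part i f) w =
      shuffle_sum q w (\<lambda>u v. (if num_Y w = i + j then 1 else 0) * (g u * hom_part i f v))"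
    unfolding conv_def by (rule shuffle_sum_cong) (auto simp: scale_by_def)
  then show ?thesis by (simp only: shuffle_sum_mult) (simp add: conv_def)
qed

section \<open>Commutation of homogeneous components\<close>

text \<open>Stronger than commutation of \<open>f\<close> and \<open>g\<close> as wholes: this form
  survives any rescaling of components, in particular \<open>dilate\<close> and
  \<open>euler\<close>.\<close>

definition graded_commute :: "'a::field \<Rightarrow> (word \<Rightarrow> 'a) \<Rightarrow> (word \<Rightarrow> 'a) \<Rightarrow> bool" where
  "graded_commute q f g \<longleftrightarrow>
     (\<forall>i j. conv q (hom_part i f) (hom_part j g) = conv q (hom_part j g) (hom_part i f))"

lemma graded_commute_sym: "graded_commute q f g \<Longrightarrow> graded_commute q g f"
  by (auto simp: graded_commute_def)

lemma graded_commuteI: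
  assumes "\<And>i. conv q (hom_part i f) g = conv q g (hom_part i f)"
  shows "graded_commute q f g"
  unfolding graded_commute_def
  by (intro allI ext, subst conv_hom_part_hom_part, subst conv_hom_part_hom_part')
     (simp add: assms)

lemma graded_commute_hom_part:
  assumes "graded_commute q f g"
  shows "conv q (hom_part i f) g = conv q g (hom_part i f)"
  using assms unfolding graded_commute_def fun_eq_iff
  by (subst conv_eq_sum_hom_part_right, subst conv_eq_sum_hom_part_left) simp

lemma graded_commuteD:
  assumes "graded_commute q f g"
  shows "conv q f g = conv q g f"
  unfolding fun_eq_iff
  by (subst conv_eq_sum_hom_part_left, subst (2) conv_eq_sum_hom_part_right)
     (simp add: graded_commute_hom_part[OF assms])

lemma hom_part_scale_by: "hom_part j (scale_by c f) = (\<lambda>w. c j * hom_part j f w)"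
  by (auto simp: scale_by_def)

lemma graded_commute_scale_by:
  assumes "graded_commute q f g"
  shows "graded_commute q f (scale_by c g)"
proof -
  show ?thesis
    using assms unfolding graded_commute_def hom_part_scale_by
    by (simp add: fun_eq_iff conv_mult_left conv_mult_right)
qed

lemma graded_commute_conv:
  assumes "q \<noteq> 0" "graded_commute q f g" "graded_commute q f h"
  shows "graded_commute q f (conv q g h)"
proof (rule graded_commuteI)
  fix i
  have "conv q (hom_part i f) (conv q g h) = conv q (conv q g (hom_part i f)) h"
    by (simp add: conv_assoc[OF assms(1), symmetric] graded_commute_hom_part[OF assms(2)])
  also have "\<dots> = conv q (conv q g h) (hom_part i f)"
    by (simp add: conv_assoc[OF assms(1)] graded_commute_hom_part[OF assms(3)])
  finally show "conv q (hom_part i f) (conv q g h) = conv q (conv q g h) (hom_part i f)" .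
qed

lemma graded_commute_inverse:
  assumes "q \<noteq> 0" "graded_commute q f g" "conv q g h = counit" "conv q h g = counit"
  shows "graded_commute q f h"
proof (rule graded_commuteI)
  fix i
  let ?f = "hom_part i f"
  have "conv q ?f h = conv q (conv q h g) (conv q ?f h)" by (simp add: assms(4))
  also have "\<dots> = conv q h (conv q (conv q ?f g) h)"
    by (simp add: conv_assoc[OF assms(1)] graded_commute_hom_part[OF assms(2)])
  also have "\<dots> = conv q h ?f"
    by (simp add: conv_assoc[OF assms(1)] assms(3))
  finally show "conv q ?f h = conv q h ?f" .
qed

section \<open>Weighted lattice paths\<close>

text \<open>
  \<open>w\<close> is read as a path from height \<open>h\<close> to \<open>0\<close>. Both weights of the edge between \<open>k\<close> and \<open>Suc k\<close>
  are indexed by \<open>k\<close>: \<open>a k\<close> for the step up and \<open>b k\<close> for the step down.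
\<close>

primrec walk :: "(nat \<Rightarrow> 'a::comm_ring_1) \<Rightarrow> (nat \<Rightarrow> 'a) \<Rightarrow> word \<Rightarrow> nat \<Rightarrow> 'a" where
  "walk a b [] h = (if h = 0 then 1 else 0)"
| "walk a b (c # w) h =
     (case c of X \<Rightarrow> a h * walk a b w (Suc h)
      | Y \<Rightarrow> (case h of 0 \<Rightarrow> 0 | Suc k \<Rightarrow> b k * walk a b w k))"

lemma walk_nonzero_height: "walk a b w h \<noteq> 0 \<Longrightarrow> height w = - int h"
proof (induction w arbitrary: h)
  case (Cons c w)
  show ?case
  proof (cases c)
    case X
    with Cons.prems have "walk a b w (Suc h) \<noteq> 0" by auto
    from Cons.IH[OF this] X show ?thesis by simp
  next
    case Y
    with Cons.prems obtain k where "h = Suc k" "b k * walk a b w k \<noteq> 0" by (cases h) auto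
    then have "walk a b w k \<noteq> 0" by (metis mult_zero_right)
    with Cons.IH[of k] \<open>h = Suc k\<close> Y show ?thesis by simp
  qed
qed (auto split: if_splits)

text \<open>Multiplying the value at height \<open>h\<close> by the up weights below
  \<open>h\<close> is a change of basis that moves the whole weight of each edge to its down
  step.\<close>

lemma walk_normalize:
  "(\<Prod>k<h. a k) * walk a b w h = walk (\<lambda>_. 1) (\<lambda>k. a k * b k) w h"
proof (induction w arbitrary: h)
  case (Cons c w)
  show ?case
    using Cons.IH[of "Suc h"] Cons.IH[of "h - 1"]
    by (cases c; cases h) (simp_all add: mult_ac)
qed simp

text \<open>A path from 0 to 0 crosses each edge equally often in both directions, so only the
  product of its two weights counts.\<close>

lemma walk_cong_edges:
  assumes "\<And>k. a k * b k = a' k * b' k"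
  shows "walk a b w 0 = walk a' b' w 0"
  using walk_normalize[of a 0 b w] walk_normalize[of a' 0 b' w] by (simp add: assms)

lemma walk_scale:
  "walk a (\<lambda>k. c * b k) w h = c ^ num_Y w * walk a b w h"
proof (induction w arbitrary: h)
  case (Cons d w)
  then show ?case by (cases d; cases h) (simp_all add: mult_ac)
qed simp

text \<open>The analogue of \<open>walk\<close> with unit up weights and a free final height:
  reversal exchanges initial and final height, so the induction needs both.\<close>

primrec walk_to :: "(nat \<Rightarrow> 'a::comm_ring_1) \<Rightarrow> nat \<Rightarrow> word \<Rightarrow> nat \<Rightarrow> 'a" where
  "walk_to g k [] h = (if h = k then 1 else 0)"
| "walk_to g k (c # w) h =
     (case c of X \<Rightarrow> walk_to g k w (Suc h)
      | Y \<Rightarrow> (case h of 0 \<Rightarrow> 0 | Suc j \<Rightarrow> g j * walk_to g k w j))"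

lemma walk_to_0: "walk_to g 0 w h = walk (\<lambda>_. 1) g w h"
proof (induction w arbitrary: h)
  case (Cons c w)
  then show ?case by (cases c; cases h) simp_all
qed simp

lemma walk_to_snoc:
  "walk_to g k (w @ [X]) h = (case k of 0 \<Rightarrow> 0 | Suc j \<Rightarrow> walk_to g j w h)"
  "walk_to g k (w @ [Y]) h = g k * walk_to g (Suc k) w h"
proof (induction w arbitrary: h)
  case Nil
  { case 1 show ?case by (cases k) auto }
  { case 2 show ?case by (cases h) auto }
next
  case (Cons c w)
  { case 1 show ?case using Cons.IH(1) by (cases c; cases k; cases h) simp_all }
  { case 2 show ?case using Cons.IH(2) by (cases c; cases h) (simp_all add: mult_ac) }
qed

text \<open>Each up step of \<open>w\<close> becomes the down step along the same edge in \<open>zeta w\<close>.\<close>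

lemma walk_to_zeta:
  "(\<Prod>j<h. g j) * walk_to g h (zeta w) k = (\<Prod>j<k. g j) * walk_to g k w h"
proof (induction w arbitrary: h)
  case (Cons c w)
  show ?case
    using Cons.IH[of "Suc h"] Cons.IH[of "h - 1"]
    by (cases c; cases h) (simp_all add: walk_to_snoc mult_ac)
qed auto

lemma walk_zeta: "walk a b (zeta w) 0 = walk a b w 0"
  using walk_to_zeta[of "\<lambda>k. a k * b k" 0 w 0]
    walk_normalize[of a 0 b w] walk_normalize[of a 0 b "zeta w"]
  by (simp add: walk_to_0)

text \<open>A path can reach 0 from above only through the lowest edge, whose down step has weight
  0.\<close>

lemma walk_eq_0:
  assumes "b 0 = 0"
  shows "walk a b w h = (if w = [] \<and> h = 0 then 1 else 0)"
proof (induction w arbitrary: h)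
  case (Cons c w)
  show ?case
  proof (cases c)
    case Y
    then show ?thesis using assms Cons.IH by (cases h) auto
  qed (simp add: Cons.IH)
qed simp

lemma poly_walk:
  "poly (walk a b w h) z = walk (\<lambda>k. poly (a k) z) (\<lambda>k. poly (b k) z) w h"
proof (induction w arbitrary: h)
  case (Cons c w)
  then show ?case by (cases c; cases h) simp_all
qed simp

section \<open>The two-parameter path series and its factorisation\<close>

definition qnum :: "'a::field \<Rightarrow> nat \<Rightarrow> 'a" where
  "qnum q n = (q ^ n - inverse q ^ n) / (q - inverse q)"

text \<open>With \<open>q powi m\<close> for \<open>\<beta>\<close> and its inverse for
  \<open>\<alpha>\<close> this is \<open>q_int q (int k + m)\<close>; the two powers become
  independent parameters so that either can be set to 0.\<close>

definition edge_weight :: "'a::field \<Rightarrow> 'a \<Rightarrow> 'a \<Rightarrow> nat \<Rightarrow> 'a" where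
  "edge_weight q \<alpha> \<beta> k = (\<beta> * q ^ k - \<alpha> * inverse q ^ k) / (q - inverse q)"

text \<open>
  \<open>fused q (1 / z) z\<close> is \<open>\<Delta>\<^sup>(\<^sup>m\<^sup>)\<close> for \<open>z = q\<^sup>m\<close>; the factors \<open>A\<close> and \<open>B\<close> are \<open>fused q 0 1\<close> and
  \<open>fused q 1 0\<close>.
\<close>

definition fused :: "'a::field \<Rightarrow> 'a \<Rightarrow> 'a \<Rightarrow> word \<Rightarrow> 'a" where
  "fused q \<alpha> \<beta> w = walk (\<lambda>k. qnum q (Suc k)) (edge_weight q \<alpha> \<beta>) w 0"

lemma conv_Cons:
  "conv q f g (c # w) =
     conv q (\<lambda>u. f (c # u)) g w + conv q (\<lambda>u. letter_weight q c u * f u) (\<lambda>v. g (c # v)) w"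
  by (simp add: conv_def mult.assoc)

lemma sum_telescope_shift:
  fixes c :: "nat \<Rightarrow> 'a::comm_ring_1"
  assumes "c 0 = s 0" "\<And>i. i \<le> h \<Longrightarrow> c (Suc i) = p i + s (Suc i)" "s (Suc h) = 0"
  shows "(\<Sum>i\<le>h. p i * V (Suc i) + s i * V i) = (\<Sum>i\<le>Suc h. c i * V i)"
proof -
  have "(\<Sum>i\<le>Suc h. c i * V i) = s 0 * V 0 + (\<Sum>i\<le>h. (p i + s (Suc i)) * V (Suc i))"
    by (subst sum.atMost_Suc_shift) (simp add: assms(1,2))
  also have "\<dots> = (\<Sum>i\<le>h. p i * V (Suc i)) + (\<Sum>i\<le>Suc h. s i * V i)"
    by (subst sum.atMost_Suc_shift) (simp add: algebra_simps sum.distrib)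
  finally show ?thesis by (simp add: assms(3) sum.distrib)
qed

lemma qnum_add:
  "qnum q (Suc (i + j)) = q ^ j * qnum q (Suc i) + inverse q ^ Suc i * qnum q j"
  by (simp add: qnum_def add_divide_distrib[symmetric] algebra_simps power_add)

text \<open>With \<open>j = h - i\<close> this is \<open>qnum_add\<close> multiplied by
  \<open>inverse q ^ (Suc i * j)\<close>.\<close>

lemma fusion_coeff_X:
  assumes "q \<noteq> 0" "i \<le> h"
  shows "qnum q (Suc h) * inverse q ^ (Suc i * (h - i)) =
    inverse q ^ (i * (h - i)) * qnum q (Suc i) +
    inverse q ^ (Suc i * (h - Suc i) + 2 * Suc i) * qnum q (h - i)"
proof -
  define j where "j = h - i"
  have h: "h = i + j" using assms(2) by (simp add: j_def)
  have 1: "inverse q ^ (i * j) = inverse q ^ (Suc i * j) * q ^ j"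
    using assms(1) by (simp add: power_add power_inverse)
  \<comment> \<open>At \<open>j = 0\<close> the truncated \<open>j - 1\<close> spoils the exponent,
    but there \<open>qnum q j\<close> vanishes.\<close>
  have 2: "inverse q ^ (Suc i * (j - 1) + 2 * Suc i) * qnum q j =
      inverse q ^ (Suc i * j) * (inverse q ^ Suc i * qnum q j)"
  proof (cases j)
    case 0 then show ?thesis by (simp add: qnum_def)
  next
    case (Suc k)
    have "Suc i * (j - 1) + 2 * Suc i = Suc i * j + Suc i" by (simp add: Suc algebra_simps)
    then show ?thesis by (simp only: power_add mult.assoc)
  qed
  have "h - i = j" "h - Suc i = j - 1" by (simp_all add: h)
  then show ?thesis
    by (simp only: 1 2 h qnum_add) (simp add: algebra_simps)
qed

text \<open>
  The words read off a weighted path are matrix coefficients of an evaluation module; the sum below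
  is a vector of a tensor product of two such modules generating a submodule of the same kind.
\<close>

lemma fusion:
  fixes q \<alpha> \<beta> :: "'a::field"
  assumes "q \<noteq> 0"
  defines "B \<equiv> walk (\<lambda>k. qnum q (Suc k)) (edge_weight q \<alpha> 0)"
    and "A \<equiv> walk (\<lambda>k. qnum q (Suc k)) (edge_weight q 0 \<beta>)"
    and "C \<equiv> walk (\<lambda>k. qnum q (Suc k)) (edge_weight q \<alpha> \<beta>)"
  shows "(\<Sum>i\<le>h. inverse q ^ (i * (h - i)) * conv q (\<lambda>u. B u i) (\<lambda>v. A v (h - i)) w) = C w h"
proof (induction w arbitrary: h)
  case Nil
  have "(\<Sum>i\<le>h. inverse q ^ (i * (h - i)) * conv q (\<lambda>u. B u i) (\<lambda>v. A v (h - i)) []) =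
     (\<Sum>i\<le>h. if i = 0 then (if h = 0 then 1 else 0) else 0)"
    by (rule sum.cong) (auto simp: A_def B_def conv_def)
  then show ?case by (simp add: C_def)
next
  case (Cons c w)
  define V where "V = (\<lambda>i j. conv q (\<lambda>u. B u i) (\<lambda>v. A v j) w)"
  have IH: "C w h = (\<Sum>i\<le>h. inverse q ^ (i * (h - i)) * V i (h - i))" for h
    using Cons.IH[of h] by (simp add: V_def)
  show ?case
  proof (cases c)
    case X
    \<comment> \<open>\<open>B u i\<close> is nonzero only for \<open>u\<close> of height
      \<open>- int i\<close>, so the weight of crossing \<open>u\<close> is a scalar determined by
      the index.\<close>
    have lw: "letter_weight q X u * B u i = inverse q ^ (2 * i) * B u i" for u i
    proof (cases "B u i = 0")
      case False
      then have "height u = - int i" unfolding B_def by (rule walk_nonzero_height)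
      then show ?thesis
        by (simp add: letter_weight_eq_height power_int_def nat_mult_distrib)
    qed simp
    have "conv q (\<lambda>u. B u i) (\<lambda>v. A v (h - i)) (c # w) =
       qnum q (Suc i) * V (Suc i) (h - i) + inverse q ^ (2 * i) * qnum q (Suc (h - i)) * V i (Suc (h - i))"
      for i
      by (simp add: X conv_Cons lw V_def conv_mult_left conv_mult_right mult.assoc)
         (simp add: B_def A_def conv_mult_left conv_mult_right)
    then have "(\<Sum>i\<le>h. inverse q ^ (i * (h - i)) * conv q (\<lambda>u. B u i) (\<lambda>v. A v (h - i)) (c # w)) =
       (\<Sum>i\<le>h. inverse q ^ (i * (h - i)) * qnum q (Suc i) * V (Suc i) (Suc h - Suc i) +
          inverse q ^ (i * (h - i) + 2 * i) * qnum q (Suc h - i) * V i (Suc h - i))"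
      by (intro sum.cong) (simp_all only: power_add atMost_iff Suc_diff_le diff_Suc_Suc distrib_left mult_ac)
    also have "\<dots> = (\<Sum>i\<le>Suc h. qnum q (Suc h) * inverse q ^ (i * (Suc h - i)) * V i (Suc h - i))"
    \<comment> \<open>The \<open>p\<close> terms raise the first index, the \<open>s\<close> terms
      the second; \<open>s (Suc h)\<close> vanishes through \<open>qnum q 0\<close>.\<close>
    proof (rule sum_telescope_shift[where V = "\<lambda>i. V i (Suc h - i)"])
      fix i assume "i \<le> h"
      then show "qnum q (Suc h) * inverse q ^ (Suc i * (Suc h - Suc i)) =
         inverse q ^ (i * (h - i)) * qnum q (Suc i) +
         inverse q ^ (Suc i * (h - Suc i) + 2 * Suc i) * qnum q (Suc h - Suc i)"
        using fusion_coeff_X[OF assms(1)] by simp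
    qed (simp_all add: qnum_def)
    also have "\<dots> = qnum q (Suc h) * C w (Suc h)"
      by (simp only: IH sum_distrib_left mult.assoc)
    finally show ?thesis by (simp add: X C_def)
  next
    case Y
    have lw: "letter_weight q Y u * B u i = q ^ (2 * i) * B u i" for u i
    proof (cases "B u i = 0")
      case False
      then have "height u = - int i" unfolding B_def by (rule walk_nonzero_height)
      then show ?thesis
        by (simp add: letter_weight_eq_height power_int_def nat_mult_distrib)
    qed simp
    have conv_Y: "conv q (\<lambda>u. B u i) (\<lambda>v. A v j) (c # w) =
       (case i of 0 \<Rightarrow> 0 | Suc i' \<Rightarrow> edge_weight q \<alpha> 0 i' * V i' j) +
       q ^ (2 * i) * (case j of 0 \<Rightarrow> 0 | Suc j' \<Rightarrow> edge_weight q 0 \<beta> j' * V i j')" for i j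
    proof -
      have "(\<lambda>u. B (Y # u) i) = (\<lambda>u. case i of 0 \<Rightarrow> 0 | Suc i' \<Rightarrow> edge_weight q \<alpha> 0 i' * B u i')"
        by (cases i) (simp_all add: B_def)
      moreover have "(\<lambda>v. A (Y # v) j) = (\<lambda>v. case j of 0 \<Rightarrow> 0 | Suc j' \<Rightarrow> edge_weight q 0 \<beta> j' * A v j')"
        by (cases j) (simp_all add: A_def)
      moreover have "conv q (\<lambda>_. 0) g w = 0" "conv q f (\<lambda>_. 0) w = 0" for f g
        by (simp_all add: conv_def)
      ultimately show ?thesis
        by (simp add: Y conv_Cons lw V_def split: nat.split)
           (simp add: conv_mult_left conv_mult_right)
    qed
    show ?thesis
    proof (cases h)
      case 0
      then show ?thesis by (simp add: conv_Y) (simp add: Y C_def)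
    next
      case (Suc k)
      \<comment> \<open>A down step reaches the index pair \<open>i\<close>, \<open>k - i\<close>
        from \<open>Suc i\<close> in the first place or from \<open>Suc (k - i)\<close> in the
        second; both contributions together give the fused edge weight.\<close>
      have coeff: "inverse q ^ (Suc i * (k - i)) * edge_weight q \<alpha> 0 i +
          inverse q ^ (i * Suc (k - i)) * q ^ (2 * i) * edge_weight q 0 \<beta> (k - i) =
          edge_weight q \<alpha> \<beta> k * inverse q ^ (i * (k - i))" if "i \<le> k" for i
      proof -
        define j where "j = k - i"
        have k: "k = i + j" using that by (simp add: j_def)
        have "inverse q ^ (i * Suc j) * q ^ (2 * i) * q ^ j = inverse q ^ (i * j) * q ^ (i + j)"
          using assms(1) by (simp add: power_add power_inverse mult_2)
        moreover have "inverse q ^ (Suc i * j) * inverse q ^ i = inverse q ^ (i * j) * inverse q ^ (i + j)"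
          by (simp add: power_add[symmetric] algebra_simps)
        ultimately show ?thesis
          unfolding j_def[symmetric] unfolding k edge_weight_def
          by (simp add: diff_divide_distrib algebra_simps)
      qed
      have "(\<Sum>i\<le>h. inverse q ^ (i * (h - i)) * conv q (\<lambda>u. B u i) (\<lambda>v. A v (h - i)) (c # w)) =
        (\<Sum>i\<le>Suc k. inverse q ^ (i * (Suc k - i)) *
            (case i of 0 \<Rightarrow> 0 | Suc i' \<Rightarrow> edge_weight q \<alpha> 0 i' * V i' (Suc k - i))) +
        (\<Sum>i\<le>Suc k. inverse q ^ (i * (Suc k - i)) * q ^ (2 * i) *
            (case Suc k - i of 0 \<Rightarrow> 0 | Suc j' \<Rightarrow> edge_weight q 0 \<beta> j' * V i j'))"
        by (simp only: Suc conv_Y distrib_left sum.distrib mult.assoc)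
      also have "\<dots> = (\<Sum>i\<le>k. inverse q ^ (Suc i * (k - i)) * edge_weight q \<alpha> 0 i * V i (k - i)) +
        (\<Sum>i\<le>k. inverse q ^ (i * Suc (k - i)) * q ^ (2 * i) * edge_weight q 0 \<beta> (k - i) * V i (k - i))"
      proof (intro arg_cong2[of _ _ _ _ "(+)"])
        show "(\<Sum>i\<le>Suc k. inverse q ^ (i * (Suc k - i)) *
            (case i of 0 \<Rightarrow> 0 | Suc i' \<Rightarrow> edge_weight q \<alpha> 0 i' * V i' (Suc k - i))) =
          (\<Sum>i\<le>k. inverse q ^ (Suc i * (k - i)) * edge_weight q \<alpha> 0 i * V i (k - i))"
          by (subst sum.atMost_Suc_shift) (simp add: mult.assoc)
        have "(\<Sum>i\<le>Suc k. inverse q ^ (i * (Suc k - i)) * q ^ (2 * i) *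
            (case Suc k - i of 0 \<Rightarrow> 0 | Suc j' \<Rightarrow> edge_weight q 0 \<beta> j' * V i j')) =
          (\<Sum>i\<le>k. inverse q ^ (i * (Suc k - i)) * q ^ (2 * i) *
            (case Suc k - i of 0 \<Rightarrow> 0 | Suc j' \<Rightarrow> edge_weight q 0 \<beta> j' * V i j'))"
          by simp
        also have "\<dots> = (\<Sum>i\<le>k. inverse q ^ (i * Suc (k - i)) * q ^ (2 * i) *
            edge_weight q 0 \<beta> (k - i) * V i (k - i))"
          by (rule sum.cong) (simp_all add: Suc_diff_le mult.assoc)
        finally show "(\<Sum>i\<le>Suc k. inverse q ^ (i * (Suc k - i)) * q ^ (2 * i) *
            (case Suc k - i of 0 \<Rightarrow> 0 | Suc j' \<Rightarrow> edge_weight q 0 \<beta> j' * V i j')) =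
          (\<Sum>i\<le>k. inverse q ^ (i * Suc (k - i)) * q ^ (2 * i) *
            edge_weight q 0 \<beta> (k - i) * V i (k - i))" .
      qed
      also have "\<dots> = (\<Sum>i\<le>k. edge_weight q \<alpha> \<beta> k * inverse q ^ (i * (k - i)) * V i (k - i))"
        by (simp only: sum.distrib[symmetric] distrib_right[symmetric])
           (rule sum.cong, simp_all only: coeff atMost_iff)
      also have "\<dots> = edge_weight q \<alpha> \<beta> k * C w k"
        by (simp only: IH sum_distrib_left mult.assoc)
      finally show ?thesis by (simp add: Y Suc C_def)
    qed
  qed
qed

text \<open>At height 0 the vector in \<open>fusion\<close> has the single term
  \<open>i = 0\<close>.\<close>

lemma fused_conv:
  assumes "q \<noteq> 0"
  shows "conv q (fused q \<alpha> 0) (fused q 0 \<beta>) = fused q \<alpha> \<beta>"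
  using fusion[OF assms, of 0 \<alpha> \<beta>] by (simp add: fused_def[abs_def] fun_eq_iff)

lemma fused_zeta: "fused q \<alpha> \<beta> (zeta w) = fused q \<alpha> \<beta> w"
  by (simp add: fused_def walk_zeta)

lemma fused_conv':
  assumes "q \<noteq> 0"
  shows "conv q (fused q 0 \<beta>) (fused q \<alpha> 0) = fused q \<alpha> \<beta>"
proof
  fix w
  have "fused q \<alpha> \<beta> w = conv q (fused q \<alpha> 0) (fused q 0 \<beta>) (zeta w)"
    by (simp add: fused_conv[OF assms] fused_zeta)
  then show "conv q (fused q 0 \<beta>) (fused q \<alpha> 0) w = fused q \<alpha> \<beta> w"
    by (simp add: conv_zeta[OF assms] fused_zeta)
qed

text \<open>The weight of the lowest edge has numerator \<open>1 - 1\<close>, so no nonempty path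
  returns to 0. Hence \<open>fused q 0 1\<close> and \<open>fused q 1 0\<close> are mutually
  inverse.\<close>

lemma fused_1_1: "fused q 1 1 = counit"
  by (rule ext) (simp add: fused_def counit_def walk_eq_0 edge_weight_def)

lemma fused_dilate: "fused q (c * \<alpha>) (c * \<beta>) = dilate c (fused q \<alpha> \<beta>)"
proof -
  have "edge_weight q (c * \<alpha>) (c * \<beta>) = (\<lambda>k. c * edge_weight q \<alpha> \<beta> k)"
    by (simp add: edge_weight_def fun_eq_iff algebra_simps)
  then show ?thesis by (intro ext) (simp only: fused_def scale_by_def walk_scale)
qed

lemma fused_0: "fused q 0 \<beta> = dilate \<beta> (fused q 0 1)" "fused q \<alpha> 0 = dilate \<alpha> (fused q 1 0)"
  using fused_dilate[of q \<beta> 0 1] fused_dilate[of q \<alpha> 1 0] by simp_all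

section \<open>Commutation and differentiation in the scaling parameter\<close>

lemma fused_eq_sum:
  assumes "q \<noteq> 0"
  shows "fused q 1 z w = (\<Sum>i\<le>num_Y w. z ^ i * conv q (fused q 1 0) (hom_part i (fused q 0 1)) w)"
    and "fused q 1 z w = (\<Sum>i\<le>num_Y w. z ^ i * conv q (hom_part i (fused q 0 1)) (fused q 1 0) w)"
proof -
  show "fused q 1 z w = (\<Sum>i\<le>num_Y w. z ^ i * conv q (fused q 1 0) (hom_part i (fused q 0 1)) w)"
    by (subst fused_conv[OF assms, symmetric], subst fused_0(1), subst conv_eq_sum_hom_part_right)
       (simp only: hom_part_scale_by conv_mult_right)
  show "fused q 1 z w = (\<Sum>i\<le>num_Y w. z ^ i * conv q (hom_part i (fused q 0 1)) (fused q 1 0) w)"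
    by (subst fused_conv'[OF assms, symmetric], subst fused_0(1), subst conv_eq_sum_hom_part_left)
       (simp only: hom_part_scale_by conv_mult_left)
qed

lemma graded_commute_fused_0_1_fused_1_0:
  fixes q :: "'a::field_char_0"
  assumes "q \<noteq> 0"
  shows "graded_commute q (fused q 0 1) (fused q 1 0)"
proof (rule graded_commuteI, rule ext)
  fix i w
  let ?c = "\<lambda>i. conv q (fused q 1 0) (hom_part i (fused q 0 1)) w"
  let ?d = "\<lambda>i. conv q (hom_part i (fused q 0 1)) (fused q 1 0) w"
  show "?d i = ?c i"
  proof (cases "i \<le> num_Y w")
    case True
    \<comment> \<open>Both polynomials take the value \<open>fused q 1 z w\<close> at every
      \<open>z\<close>; over an infinite field this forces equal coefficients.\<close>
    have "poly (\<Sum>i\<le>num_Y w. monom (?c i) i) = poly (\<Sum>i\<le>num_Y w. monom (?d i) i)"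
      using fused_eq_sum[OF assms] by (simp add: fun_eq_iff poly_sum poly_monom mult.commute)
    then have "coeff (\<Sum>i\<le>num_Y w. monom (?c i) i) i = coeff (\<Sum>i\<le>num_Y w. monom (?d i) i) i"
      by (simp only: poly_eq_poly_eq_iff)
    then show ?thesis using True by (simp add: coeff_sum)
  next
    case False
    have "?c i = conv q (\<lambda>_. 0) (\<lambda>_. 0) w" by (rule conv_cong) (use False in \<open>simp add: scale_by_def\<close>)
    moreover have "?d i = conv q (\<lambda>_. 0) (\<lambda>_. 0) w"
      by (rule conv_cong) (use False in \<open>simp add: scale_by_def\<close>)
    ultimately show ?thesis by simp
  qed
qed

text \<open>The factor of the first letter is omitted, so the path is weighted only from height 1
  on, with the weights for \<open>m = 0\<close>. The value 0 at the empty word leaves the exponent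
  without constant term.\<close>

definition nabla_coeff :: "'a::field \<Rightarrow> word \<Rightarrow> 'a" where
  "nabla_coeff q w = (case w of X # w' \<Rightarrow> walk (qnum q) (\<lambda>k. qnum q (Suc k)) w' 1 | _ \<Rightarrow> 0)"

lemma conv_euler_fused:
  fixes q :: "'a::field_char_0"
  assumes "q \<noteq> 0"
  shows "conv q (euler (fused q 0 1)) (fused q 1 0) w = nabla_coeff q w / (q - inverse q)"
proof -
  let ?d = "\<lambda>i. conv q (hom_part i (fused q 0 1)) (fused q 1 0) w"
  define \<delta> where "\<delta> = 1 / (q - inverse q)"
  \<comment> \<open>\<open>a k\<close> is \<open>edge_weight q 1 z k\<close> as a polynomial in
    \<open>z\<close>. It is put on the up steps so that the first letter contributes
    \<open>a 0\<close>, which vanishes at 1.\<close>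
  define a where "a = (\<lambda>k. [:- (\<delta> * inverse q ^ k), \<delta> * q ^ k:])"
  define P where "P = walk a (\<lambda>k. [:qnum q (Suc k):])"
  have "poly (\<Sum>i\<le>num_Y w. monom (?d i) i) z = poly (P w 0) z" for z
  proof -
    have "poly (P w 0) z = fused q 1 z w"
      unfolding P_def poly_walk fused_def
      by (rule walk_cong_edges) (simp add: a_def edge_weight_def \<delta>_def algebra_simps diff_divide_distrib)
    then show ?thesis using fused_eq_sum(2)[OF assms] by (simp add: poly_sum poly_monom mult.commute)
  qed
  then have P: "(\<Sum>i\<le>num_Y w. monom (?d i) i) = P w 0"
    by (simp add: fun_eq_iff flip: poly_eq_poly_eq_iff)
  have "conv q (euler (fused q 0 1)) (fused q 1 0) w = (\<Sum>i\<le>num_Y w. of_nat i * ?d i)"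
    by (subst conv_eq_sum_hom_part_left) (simp only: hom_part_scale_by conv_mult_left)
  \<comment> \<open>Differentiation in \<open>z\<close> at 1 multiplies the coefficient of index
    \<open>i\<close> by \<open>i\<close>, just as \<open>euler\<close> does on the first
    factor.\<close>
  also have "\<dots> = poly (pderiv (\<Sum>i\<le>num_Y w. monom (?d i) i)) 1"
    by (simp add: higher_pderiv_sum[of 1, simplified] poly_sum pderiv_monom poly_monom)
  also have "\<dots> = nabla_coeff q w * \<delta>"
  proof (cases w)
    case Nil
    then show ?thesis unfolding P by (simp add: P_def nabla_coeff_def pderiv_1)
  next
    case (Cons c w')
    show ?thesis
    proof (cases c)
      case X
      have "poly (P w' 1) 1 = walk (qnum q) (\<lambda>k. qnum q (Suc k)) w' 1"
        unfolding P_def poly_walk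
        by (simp add: a_def qnum_def[abs_def] \<delta>_def diff_divide_distrib)
      \<comment> \<open>As \<open>a 0\<close> vanishes at 1, the product rule leaves only its
        derivative \<open>\<delta>\<close> times the rest of the path at 1.\<close>
      moreover have "P w 0 = a 0 * P w' 1" by (simp add: P_def Cons X)
      ultimately show ?thesis
        unfolding P by (simp add: nabla_coeff_def Cons X a_def pderiv_diff pderiv_smult pderiv_pCons)
    next
      case Y
      then show ?thesis unfolding P by (simp add: P_def nabla_coeff_def Cons)
    qed
  qed
  finally show ?thesis by (simp add: \<delta>_def)
qed

section \<open>The exponential as solution of a first order equation\<close>

primrec conv_power :: "'a::field \<Rightarrow> (word \<Rightarrow> 'a) \<Rightarrow> nat \<Rightarrow> word \<Rightarrow> 'a" where
  "conv_power q f 0 = counit"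
| "conv_power q f (Suc k) = conv q f (conv_power q f k)"

lemma conv_nonzeroE:
  assumes "conv q f g w \<noteq> 0"
  obtains u v where "f u \<noteq> 0" "g v \<noteq> 0" "height u + height v = height w"
    "num_Y u + num_Y v = num_Y w"
proof (rule ccontr)
  assume "\<not> thesis"
  then have "conv q f g w = conv q (\<lambda>_. 0) (\<lambda>_. 0) w"
    using that by (intro conv_cong) auto
  with assms show False by (simp add: conv_def)
qed

text \<open>Each factor contributes height 0 and at least one Y, so the exponential series is a
  finite sum at each word.\<close>

lemma conv_power_nonzero:
  assumes "\<And>w. f w \<noteq> 0 \<Longrightarrow> height w = 0 \<and> num_Y w > 0" and "conv_power q f k w \<noteq> 0"
  shows "height w = 0 \<and> k \<le> num_Y w"
  using assms(2)
proof (induction k arbitrary: w)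
  case 0
  then show ?case by (auto simp: counit_def split: if_splits)
next
  case (Suc k)
  from Suc.prems obtain u v where "f u \<noteq> 0" "conv_power q f k v \<noteq> 0"
    "height u + height v = height w" "num_Y u + num_Y v = num_Y w"
    by (auto elim: conv_nonzeroE)
  with Suc.IH[of v] assms(1)[of u] show ?case by auto
qed

text \<open>The power rule for the derivation \<open>euler\<close>, valid because \<open>f\<close>
  commutes with its own derivative.\<close>

lemma euler_conv_power:
  assumes "q \<noteq> 0" and "conv q (euler f) f = conv q f (euler f)"
  shows "euler (conv_power q f (Suc k)) w = of_nat (Suc k) * conv q (euler f) (conv_power q f k) w"
proof (induction k arbitrary: w)
  case 0
  have "euler counit = (\<lambda>_. 0 :: 'a)" by (auto simp: scale_by_def counit_def)
  then show ?case by (simp add: euler_conv conv_def)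
next
  case (Suc k)
  have "conv q f (euler (conv_power q f (Suc k))) w =
      of_nat (Suc k) * conv q f (conv q (euler f) (conv_power q f k)) w"
    by (simp only: Suc.IH[abs_def] conv_mult_right)
  also have "conv q f (conv q (euler f) (conv_power q f k)) =
      conv q (euler f) (conv_power q f (Suc k))"
    by (simp add: conv_assoc[OF assms(1), symmetric] assms(2))
  finally have "conv q f (euler (conv_power q f (Suc k))) w =
      of_nat (Suc k) * conv q (euler f) (conv_power q f (Suc k)) w" .
  moreover have "euler (conv_power q f (Suc (Suc k))) w =
      conv q (euler f) (conv_power q f (Suc k)) w + conv q f (euler (conv_power q f (Suc k))) w"
    by (subst conv_power.simps(2), subst euler_conv) simp
  ultimately show ?case by (simp only: of_nat_Suc[of "Suc k"] distrib_right mult_1_left)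
qed

text \<open>The equation determines \<open>D\<close> degree by degree: as \<open>f\<close> has no
  part in degree 0, \<open>of_nat (num_Y w) * D w\<close> involves \<open>D\<close> only at words
  with fewer Y, and characteristic zero permits the division.\<close>

lemma eq_conv_exp:
  fixes f :: "word \<Rightarrow> 'a::field_char_0"
  assumes "q \<noteq> 0"
    and f: "\<And>w. f w \<noteq> 0 \<Longrightarrow> height w = 0 \<and> num_Y w > 0"
    and commute: "conv q (euler f) f = conv q f (euler f)"
    and D: "D [] = 1" "\<And>w. D w \<noteq> 0 \<Longrightarrow> height w = 0" "\<And>w. euler D w = conv q (euler f) D w"
    and "num_Y w \<le> N"
  shows "D w = (\<Sum>k\<le>N. conv_power q f k w / fact k)"
  using \<open>num_Y w \<le> N\<close>
proof (induction "num_Y w" arbitrary: w N rule: less_induct)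
  case less
  show ?case
  proof (cases "height w = 0")
    case False
    then have "conv_power q f k w = 0" for k using conv_power_nonzero[of f q k w, OF f] by auto
    with False D(2)[of w] show ?thesis by auto
  next
    case height: True
    show ?thesis
    proof (cases "num_Y w = 0")
      case True
      then have w: "w = []" using length_eq_height[of w] height by simp
      have "(\<Sum>k\<le>N. conv_power q f k w / fact k) = (\<Sum>k\<le>N. if k = 0 then 1 else 0)"
      proof (rule sum.cong)
        fix k show "conv_power q f k w / fact k = (if k = 0 then 1 else 0)"
          using conv_power_nonzero[of f q k w, OF f] True
          by (cases k) (auto simp: w counit_def)
      qed simp
      then show ?thesis by (simp add: w D(1))
    next
      case False
      with less.prems obtain M where N: "N = Suc M" by (cases N) auto
      \<comment> \<open>One summand fewer suffices: the relevant \<open>v\<close> have fewer Y than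
        \<open>w\<close>, and the power rule shifts the index of the sum back up by one.\<close>
      have "euler D w = conv q (euler f) (\<lambda>v. \<Sum>k\<le>M. conv_power q f k v / fact k) w"
        unfolding D(3)
      proof (rule conv_cong)
        fix u v assume Y: "num_Y u + num_Y v = num_Y w"
        show "euler f u * D v = euler f u * (\<Sum>k\<le>M. conv_power q f k v / fact k)"
        proof (cases "f u = 0")
          case False
          then have "num_Y v < num_Y w" using f[of u] Y by simp
          moreover from this have "num_Y v \<le> M" using less.prems N by simp
          ultimately show ?thesis using less.hyps by simp
        qed (simp add: scale_by_def)
      qed
      also have "\<dots> = (\<Sum>k\<le>M. conv q (euler f) (conv_power q f k) w / fact k)"
        using conv_mult_right[of q "euler f" "1 / fact _" "conv_power q f _" w]
        by (simp add: conv_sum_right)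
      also have "\<dots> = (\<Sum>k\<le>M. euler (conv_power q f (Suc k)) w / fact (Suc k))"
        by (rule sum.cong) (simp_all add: euler_conv_power[OF assms(1) commute] del: conv_power.simps of_nat_Suc)
      also have "\<dots> = of_nat (num_Y w) * (\<Sum>k\<le>M. conv_power q f (Suc k) w / fact (Suc k))"
        by (simp only: scale_by_def sum_distrib_left times_divide_eq_right)
      also have "(\<Sum>k\<le>M. conv_power q f (Suc k) w / fact (Suc k)) =
          (\<Sum>k\<le>N. conv_power q f k w / fact k)"
        unfolding N using False by (subst sum.atMost_Suc_shift) (auto simp: counit_def)
      finally show ?thesis using False by (simp add: scale_by_def)
    qed
  qed
qed

lemma nabla_coeff_nonzero: "nabla_coeff q w \<noteq> 0 \<Longrightarrow> height w = 0 \<and> num_Y w > 0"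
proof -
  assume *: "nabla_coeff q w \<noteq> 0"
  then obtain w' where w: "w = X # w'" "walk (qnum q) (\<lambda>k. qnum q (Suc k)) w' 1 \<noteq> 0"
    by (auto simp: nabla_coeff_def split: list.splits letter.splits)
  then have h: "height w = 0" using walk_nonzero_height by fastforce
  with length_eq_height[of w] w(1) show ?thesis by auto
qed

text \<open>By the Leibniz rule on the factors: the logarithmic derivative of
  \<open>fused q 0 1\<close> is \<open>N\<close>, that of its inverse \<open>fused q 1 0\<close> is
  \<open>- N\<close>. Dilating by \<open>z\<close> and \<open>inverse z\<close> and moving both
  copies of \<open>N\<close> to the front gives the difference of powers.\<close>

lemma euler_fused:
  fixes q :: "'a::field_char_0"
  assumes "q \<noteq> 0" "z \<noteq> 0"
  defines "N \<equiv> conv q (euler (fused q 0 1)) (fused q 1 0)"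
  shows "euler (fused q (inverse z) z) =
    conv q (scale_by (\<lambda>n. z ^ n - inverse z ^ n) N) (fused q (inverse z) z)"
    and "graded_commute q N N"
proof -
  let ?A = "fused q 0 1" and ?B = "fused q 1 0" and ?z' = "inverse z"
  note assoc = conv_assoc[OF assms(1)]
  have inv: "conv q ?A ?B = counit" "conv q ?B ?A = counit"
    using fused_conv[OF assms(1), of 1 1] fused_conv'[OF assms(1), of 1 1] by (simp_all add: fused_1_1)
  have AB: "graded_commute q ?A ?B"
    by (rule graded_commute_fused_0_1_fused_1_0[OF assms(1)])
  \<comment> \<open>\<open>?A\<close> commutes with \<open>?B\<close>, hence with the inverse of
    \<open>?B\<close>, which is \<open>?A\<close> itself.\<close>
  have AA: "graded_commute q ?A ?A"
    by (rule graded_commute_inverse[OF assms(1) AB inv(2,1)])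
  have BB: "graded_commute q ?B ?B"
    by (rule graded_commute_inverse[OF assms(1) graded_commute_sym[OF AB] inv])
  have AN: "graded_commute q ?A N" and BN: "graded_commute q ?B N"
    unfolding N_def
    by (intro graded_commute_conv graded_commute_scale_by assms(1) AA AB BB graded_commute_sym[OF AB])+
  show "graded_commute q N N"
    by (subst (2) N_def) (intro graded_commute_conv graded_commute_scale_by assms(1)
        graded_commute_sym[OF AN] graded_commute_sym[OF BN])
  have EA: "euler ?A = conv q N ?A"
    by (simp add: N_def assoc inv)
  have "euler counit w = (0::'a)" for w by (simp add: scale_by_def counit_def)
  then have 0: "conv q ?A (euler ?B) w = - N w" for w
    using euler_conv[of q ?A ?B w] by (simp add: inv N_def add_eq_0_iff)
  have EB: "euler ?B w = - conv q N ?B w" for w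
  proof -
    have "euler ?B = conv q ?B (conv q ?A (euler ?B))"
      by (simp add: assoc[symmetric] inv)
    also have "\<dots> = (\<lambda>w. - conv q ?B N w)"
      unfolding 0[abs_def] using conv_mult_right[of q ?B "-1" N] by (simp add: fun_eq_iff)
    also have "conv q ?B N = conv q N ?B" by (rule graded_commuteD[OF BN])
    finally show ?thesis by simp
  qed
  let ?D = "fused q ?z' z" and ?Az = "dilate z ?A" and ?Bz = "dilate ?z' ?B"
  have D: "?D = conv q ?Az ?Bz"
    by (subst fused_conv'[OF assms(1), symmetric])
       (simp only: fused_0(1)[of q z] fused_0(2)[of q ?z'])
  have comm: "conv q ?Az (dilate ?z' N) = conv q (dilate ?z' N) ?Az"
    by (intro graded_commuteD graded_commute_scale_by graded_commute_sym[OF graded_commute_scale_by] graded_commute_sym[OF AN])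
  have swap: "euler (dilate c f) = dilate c (euler f)" for c :: 'a and f
    by (simp add: scale_by_scale_by mult.commute)
  have "euler ?Az = conv q (dilate z N) ?Az"
    by (simp only: swap EA dilate_conv)
  moreover have "euler ?Bz = (\<lambda>w. - conv q (dilate ?z' N) ?Bz w)"
    by (simp add: swap dilate_conv[symmetric]) (simp add: scale_by_def EB[unfolded scale_by_def] fun_eq_iff)
  ultimately have "euler ?D w = conv q (dilate z N) ?D w - conv q (dilate ?z' N) ?D w" for w
    using conv_mult_right[of q ?Az "-1" "conv q (dilate ?z' N) ?Bz" w]
    by (simp add: D euler_conv assoc[symmetric] comm)
  moreover have "conv q (scale_by (\<lambda>n. z ^ n - ?z' ^ n) N) ?D w =
     conv q (dilate z N) ?D w - conv q (dilate ?z' N) ?D w" for w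
    using shuffle_sum_add[of q w "\<lambda>u v. scale_by (\<lambda>n. z ^ n - ?z' ^ n) N u * ?D v"
        "\<lambda>u v. dilate ?z' N u * ?D v"]
    by (simp add: conv_def scale_by_def algebra_simps)
  ultimately show "euler ?D = conv q (scale_by (\<lambda>n. z ^ n - ?z' ^ n) N) ?D"
    by (simp add: fun_eq_iff)
qed

text \<open>Division by \<open>of_nat n\<close> undoes \<open>euler\<close>, so
  \<open>euler f\<close> is the factor in \<open>euler_fused\<close>; in degree 0 both vanish
  because \<open>z ^ 0 - inverse z ^ 0\<close> is 0.\<close>

lemma fused_eq_conv_exp:
  fixes q :: "'a::field_char_0"
  assumes "q \<noteq> 0" "z \<noteq> 0" "num_Y w \<le> N"
  defines "f \<equiv> scale_by (\<lambda>n. (z ^ n - inverse z ^ n) / ((q - inverse q) * of_nat n)) (nabla_coeff q)"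
  shows "fused q (inverse z) z w = (\<Sum>k\<le>N. conv_power q f k w / fact k)"
proof (rule eq_conv_exp[OF assms(1) _ _ _ _ _ assms(3)])
  define N where "N = conv q (euler (fused q 0 1)) (fused q 1 0)"
  have N: "N w = nabla_coeff q w / (q - inverse q)" for w
    by (simp add: N_def conv_euler_fused[OF assms(1)])
  have f: "f = scale_by (\<lambda>n. (z ^ n - inverse z ^ n) / of_nat n) N"
    by (simp add: f_def scale_by_def N fun_eq_iff)
  show "height w = 0 \<and> num_Y w > 0" if "f w \<noteq> 0" for w
    using that nabla_coeff_nonzero[of q w] by (auto simp: f_def scale_by_def)
  show "conv q (euler f) f = conv q f (euler f)"
    unfolding f N_def using euler_fused(2)[OF assms(1,2)]
    by (intro graded_commuteD graded_commute_scale_by graded_commute_sym[OF graded_commute_scale_by] )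
  show "fused q (inverse z) z [] = 1" by (simp add: fused_def)
  show "height w = 0" if "fused q (inverse z) z w \<noteq> 0" for w
    using walk_nonzero_height that by (fastforce simp: fused_def)
  have "euler f = scale_by (\<lambda>n. z ^ n - inverse z ^ n) N"
    by (auto simp: f scale_by_def fun_eq_iff)
  then show "euler (fused q (inverse z) z) w = conv q (euler f) (fused q (inverse z) z) w" for w
    using euler_fused(1)[OF assms(1,2)] by (simp add: N_def)
qed

section \<open>Transfer to the free algebra and its power series\<close>

lemma lookup_scal [simp]: "Poly_Mapping.lookup (scal c p) w = c * Poly_Mapping.lookup p w"
  by (simp add: scal_def Poly_Mapping.map.rep_eq when_def)

lemma lookup_bilinear_ext:
  "Poly_Mapping.lookup (bilinear_ext b f g) w =
     (\<Sum>u\<in>Poly_Mapping.keys f. \<Sum>v\<in>Poly_Mapping.keys g.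
        Poly_Mapping.lookup f u * Poly_Mapping.lookup g v * Poly_Mapping.lookup (b u v) w)"
  by (simp add: bilinear_ext_def lookup_sum)

lemma lookup_letter_mult:
  "Poly_Mapping.lookup (letter_mult a p) w =
     (case w of [] \<Rightarrow> 0 | b # w' \<Rightarrow> if a = b then Poly_Mapping.lookup p w' else 0)"
proof -
  have "Poly_Mapping.lookup (letter_mult a p) w =
      (\<Sum>v\<in>Poly_Mapping.keys p. if a # v = w then Poly_Mapping.lookup p v else 0)"
    by (simp add: letter_mult_def free_mult_def lookup_bilinear_ext lookup_single when_def if_distrib cong: if_cong)
  also have "\<dots> = (case w of [] \<Rightarrow> 0 | b # w' \<Rightarrow> if a = b then Poly_Mapping.lookup p w' else 0)"
  proof (cases w)
    case (Cons b w')
    then show ?thesis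
      by (cases "a = b") (auto simp: sum.delta' in_keys_iff)
  qed simp
  finally show ?thesis .
qed

text \<open>Both recursions inspect the first letter of the product: it comes from the first word,
  or from the second and then crosses all of the first.\<close>

lemma lookup_q_shuffle_word:
  "Poly_Mapping.lookup (q_shuffle_word q u v) w =
     shuffle_sum q w (\<lambda>s t. if s = u \<and> t = v then 1 else 0)"
proof (induction q u v arbitrary: w rule: q_shuffle_word.induct)
  case (1 q v)
  have "shuffle_sum q w (\<lambda>s t. if s = [] \<and> t = v then 1 else 0 :: 'a) = (if w = v then 1 else 0)"
    by (subst shuffle_sum_Nil_left) auto
  then show ?case by (auto simp: lookup_single when_def)
next
  case (2 q a u)
  have "shuffle_sum q w (\<lambda>s t. if s = a # u \<and> t = [] then 1 else 0 :: 'a) = (if w = a # u then 1 else 0)"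
    by (subst shuffle_sum_Nil_right) auto
  then show ?case by (auto simp: lookup_single when_def)
next
  case (3 q a u b v)
  show ?case
  proof (cases w)
    case Nil
    then show ?thesis by (simp add: lookup_add lookup_letter_mult)
  next
    case (Cons c w')
    have "shuffle_sum q w' (\<lambda>s t. if c # s = a # u \<and> t = b # v then 1 else 0 :: 'a) =
        (if a = c then shuffle_sum q w' (\<lambda>s t. if s = u \<and> t = b # v then 1 else 0) else 0)"
      by auto
    moreover have "shuffle_sum q w'
          (\<lambda>s t. letter_weight q c s * (if s = a # u \<and> c # t = b # v then 1 else 0)) =
        (if b = c then letter_weight q b (a # u) *
           shuffle_sum q w' (\<lambda>s t. if s = a # u \<and> t = v then 1 else 0) else 0)"
      by (auto simp: shuffle_sum_mult[symmetric] intro!: shuffle_sum_cong)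
    ultimately show ?thesis
      by (simp add: Cons lookup_add lookup_letter_mult 3 letter_weight_def)
  qed
qed

lemma lookup_q_shuffle:
  "Poly_Mapping.lookup (q_shuffle q f g) = conv q (Poly_Mapping.lookup f) (Poly_Mapping.lookup g)"
proof
  fix w
  have expand: "Poly_Mapping.lookup p s =
      (\<Sum>u\<in>Poly_Mapping.keys p. Poly_Mapping.lookup p u * (if s = u then 1 else 0))" for p :: "'a free_alg" and s
    by (simp add: if_distrib in_keys_iff cong: if_cong)
  have delta: "conv q (\<lambda>s. if s = u then 1 else 0) (\<lambda>t. if t = v then 1 else 0) w =
      shuffle_sum q w (\<lambda>s t. if s = u \<and> t = v then 1 else 0)" for u v
    unfolding conv_def by (rule shuffle_sum_cong) simp
  have "conv q (Poly_Mapping.lookup f) (Poly_Mapping.lookup g) w =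
      (\<Sum>u\<in>Poly_Mapping.keys f. \<Sum>v\<in>Poly_Mapping.keys g.
        Poly_Mapping.lookup f u * (Poly_Mapping.lookup g v *
          conv q (\<lambda>s. if s = u then 1 else 0) (\<lambda>t. if t = v then 1 else 0) w))"
    by (subst expand[of f, abs_def], subst expand[of g, abs_def])
       (simp only: conv_sum_left conv_sum_right conv_mult_left conv_mult_right sum_distrib_left)
  also have "\<dots> = Poly_Mapping.lookup (q_shuffle q f g) w"
    by (simp add: q_shuffle_def lookup_bilinear_ext lookup_q_shuffle_word delta mult.assoc)
  finally show "Poly_Mapping.lookup (q_shuffle q f g) w =
      conv q (Poly_Mapping.lookup f) (Poly_Mapping.lookup g) w" ..
qed

text \<open>Words of height 0 are twice as long as their number of Y, so the exponent of
  \<open>t\<close> can be recovered from the word.\<close>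

lemma lookup_q_shuffle_power:
  assumes F: "\<And>n w. Poly_Mapping.lookup (fps_nth F n) w = (if length w = 2 * n then f w else 0)"
    and f: "\<And>w. f w \<noteq> 0 \<Longrightarrow> height w = 0 \<and> num_Y w > 0"
  shows "Poly_Mapping.lookup (fps_nth (q_shuffle_power q F k) n) w =
    (if length w = 2 * n then conv_power q f k w else 0)"
proof (induction k arbitrary: n w)
  case 0
  show ?case by (auto simp: lookup_single counit_def when_def)
next
  case (Suc k)
  let ?P = "conv_power q f k"
  have "Poly_Mapping.lookup (fps_nth (q_shuffle_power q F (Suc k)) n) w =
      (\<Sum>i\<le>n. conv q (\<lambda>u. if length u = 2 * i then f u else 0)
         (\<lambda>v. if length v = 2 * (n - i) then ?P v else 0) w)"
    by (simp add: q_shuffle_fps_def lookup_sum lookup_q_shuffle F[abs_def] Suc.IH[abs_def])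
  also have "\<dots> = shuffle_sum q w (\<lambda>u v. \<Sum>i\<le>n. (if length u = 2 * i then f u else 0) *
         (if length v = 2 * (n - i) then ?P v else 0))"
    by (simp add: shuffle_sum_sum conv_def)
  also have "\<dots> = shuffle_sum q w (\<lambda>u v. (if length w = 2 * n then 1 else 0) * (f u * ?P v))"
  proof (rule shuffle_sum_cong)
    fix u v :: word assume len: "length u + length v = length w"
    show "(\<Sum>i\<le>n. (if length u = 2 * i then f u else 0) * (if length v = 2 * (n - i) then ?P v else 0)) =
       (if length w = 2 * n then 1 else 0) * (f u * ?P v)"
    proof (cases "f u = 0 \<or> ?P v = 0")
      case True
      then show ?thesis by (auto intro!: sum.neutral)
    next
      case False
      then have "height u = 0" "height v = 0"
        using f conv_power_nonzero[of f q k v, OF f] by auto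
      then have uv: "length u = 2 * num_Y u" "length v = 2 * num_Y v"
        using length_eq_height[of u] length_eq_height[of v] by auto
      have "(\<Sum>i\<le>n. (if length u = 2 * i then f u else 0) * (if length v = 2 * (n - i) then ?P v else 0)) =
        (\<Sum>i\<le>n. if i = num_Y u then (if num_Y v = n - num_Y u then f u * ?P v else 0) else 0)"
        by (rule sum.cong) (auto simp: uv)
      also have "\<dots> = (if length w = 2 * n then 1 else 0) * (f u * ?P v)"
        using uv len by auto
      finally show ?thesis .
    qed
  qed
  finally show ?case by (simp add: shuffle_sum_mult conv_def)
qed

section \<open>Catalan words as lattice paths\<close>

lemma q_int_nat: "q_int q (int n) = qnum q n"
  by (simp add: q_int_def qnum_def power_int_minus power_inverse)

lemma all_le_Suc_iff: "(\<forall>i\<le>Suc n. P i) \<longleftrightarrow> P 0 \<and> (\<forall>i\<le>n. P (Suc i))"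
  using All_less_Suc2[of "Suc n" P] by (simp add: less_Suc_eq_le)

text \<open>\<open>F x c\<close> weights the step \<open>c\<close> by the height \<open>x\<close>
  where it starts, matching \<open>q_factor\<close>. Nonnegative prefixes are required explicitly,
  since the product alone need not vanish on a path that drops below 0.\<close>

lemma walk_eq_prod:
  assumes "\<And>k. F (int k) X = a k" "\<And>k. F (int (Suc k)) Y = b k"
  shows "walk a b w h =
    (if (\<forall>i\<le>length w. 0 \<le> int h + height (take i w)) \<and> int h + height w = 0
     then \<Prod>i<length w. F (int h + height (take i w)) (w ! i) else 0)"
proof (induction w arbitrary: h)
  case (Cons c w)
  show ?case
  proof (cases c)
    case X
    then show ?thesis
      using Cons.IH[of "Suc h"] assms(1)[of h]
      by (auto simp: all_le_Suc_iff prod.lessThan_Suc_shift algebra_simps simp del: prod.lessThan_Suc)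
  next
    case Y
    show ?thesis
    proof (cases h)
      case 0
      then have "\<not> (\<forall>i\<le>length (c # w). 0 \<le> int h + height (take i (c # w)))"
        using Y by (intro notI) (drule spec[of _ 1], simp)
      then show ?thesis using Y 0 by auto
    next
      case (Suc k)
      then show ?thesis
        using Y Cons.IH[of k] assms(2)[of k]
        by (auto simp: all_le_Suc_iff prod.lessThan_Suc_shift algebra_simps simp del: prod.lessThan_Suc)
    qed
  qed
qed auto

lemma catalan_iff: "catalan w \<longleftrightarrow> (\<forall>i\<le>length w. 0 \<le> height (take i w)) \<and> height w = 0"
proof
  assume c: "catalan w"
  have "0 \<le> height (take i w)" if "i \<le> length w" for i
    using c that by (cases "i = 0 \<or> i = length w") (auto simp: catalan_def)
  with c show "(\<forall>i\<le>length w. 0 \<le> height (take i w)) \<and> height w = 0" by (simp add: catalan_def)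
qed (auto simp: catalan_def)

lemma finite_Cat: "finite (Cat n)"
proof -
  have "(UNIV :: letter set) = {X, Y}" using letter.exhaust by blast
  then have "finite (UNIV :: letter set)" by (metis finite.emptyI finite_insert)
  then have "finite {w. set w \<subseteq> (UNIV :: letter set) \<and> length w = 2 * n}"
    by (rule finite_lists_length_eq)
  then show ?thesis by (rule finite_subset[rotated]) (auto simp: Cat_def)
qed

lemma lookup_sum_Cat:
  "Poly_Mapping.lookup (\<Sum>w\<in>Cat n. Poly_Mapping.single w (c w)) w =
     (if length w = 2 * n \<and> catalan w then c w else 0)"
  by (simp add: lookup_sum lookup_single when_def finite_Cat) (auto simp: Cat_def)

lemma lookup_Delta:
  assumes "q \<noteq> 0"
  shows "Poly_Mapping.lookup (Delta q m n) w =
    (if length w = 2 * n then fused q (inverse (q powi m)) (q powi m) w else 0)"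
proof -
  let ?F = "\<lambda>x c. q_int q (x + m * ((bar c + 1) div 2))"
  have "q_int q (int k + m) = edge_weight q (inverse (q powi m)) (q powi m) k" for k
    by (simp only: q_int_def edge_weight_def power_int_minus power_int_add[OF disjI1[OF assms]]
        inverse_mult_distrib power_int_of_nat power_inverse mult.commute)
  \<comment> \<open>The factors of \<open>Delta_word\<close> put \<open>k + m\<close> on up steps
    and \<open>Suc k\<close> on down steps, \<open>fused\<close> the other way round; closed paths
    see only the products.\<close>
  then have "fused q (inverse (q powi m)) (q powi m) w =
      walk (\<lambda>k. q_int q (int k + m)) (\<lambda>k. qnum q (Suc k)) w 0"
    unfolding fused_def by (intro walk_cong_edges) (simp add: mult.commute)
  also have "\<dots> = (if catalan w then Delta_word q m w else 0)"
    by (subst walk_eq_prod[where F = ?F])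
       (auto simp: catalan_iff Delta_word_def q_factor_def q_int_nat[symmetric] lessThan_atLeast0)
  finally show ?thesis by (auto simp: Delta_def lookup_sum_Cat)
qed

lemma lookup_nabla:
  assumes "n > 0"
  shows "Poly_Mapping.lookup (nabla q 0 n) w = (if length w = 2 * n then nabla_coeff q w else 0)"
proof (cases "length w = 2 * n")
  case True
  with assms obtain c w' where w: "w = c # w'" by (cases w) auto
  have "nabla_coeff q w = (if catalan w then nabla_word q 0 w else 0)"
  proof (cases c)
    case X
    \<comment> \<open>Removing the leading X shifts all later heights by 1, so \<open>w'\<close> is
      a path from height 1.\<close>
    have "nabla_word q 0 w = (\<Prod>i<length w'. q_int q (1 + height (take i w')))"
      unfolding nabla_word_def w q_factor_def list.size(4) add_0_right add_Suc_right One_nat_def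
        prod.shift_bounds_Suc_ivl
      by (simp add: X lessThan_atLeast0)
    moreover have "nabla_coeff q w = (if catalan w then \<Prod>i<length w'. q_int q (1 + height (take i w')) else 0)"
      unfolding nabla_coeff_def w catalan_iff list.size(4) add_0_right add_Suc_right One_nat_def all_le_Suc_iff
      using walk_eq_prod[where F = "\<lambda>x c. q_int q x" and h = 1 and w = w', OF q_int_nat q_int_nat]
      by (auto simp: X)
    ultimately show ?thesis by simp
  next
    case Y
    then have "\<not> catalan w" unfolding catalan_iff w by (auto intro!: exI[of _ 1])
    then show ?thesis by (simp add: nabla_coeff_def w Y)
  qed
  then show ?thesis using True by (simp add: nabla_def lookup_sum_Cat)
qed (simp add: nabla_def lookup_sum_Cat)

theorem theorem11p6:
  fixes q :: "'a::field_char_0" and m :: int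
  assumes "q \<noteq> 0" and "\<And>n::nat. n \<ge> 1 \<Longrightarrow> q ^ n \<noteq> 1"
  shows "Delta_fps q m =
    q_shuffle_exp q
      (Abs_fps (\<lambda>n. if n = 0 then 0
                    else scal (q_int q (m * int n) / of_nat n) (nabla q 0 n)))"
proof (rule fps_ext, rule poly_mapping_eqI)
  fix n w
  let ?F = "Abs_fps (\<lambda>n. if n = 0 then 0
    else scal (q_int q (m * int n) / of_nat n) (nabla q 0 n))"
  define z where "z = q powi m"
  have z: "z \<noteq> 0" using assms(1) by (simp add: z_def)
  define f where
    "f = scale_by (\<lambda>n. (z ^ n - inverse z ^ n) / ((q - inverse q) * of_nat n)) (nabla_coeff q)"
  have q_int: "q_int q (m * int n) = (z ^ n - inverse z ^ n) / (q - inverse q)" for n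
    by (simp add: q_int_def z_def power_int_mult power_int_minus power_inverse)
  have f: "height w = 0 \<and> num_Y w > 0" if "f w \<noteq> 0" for w
    using that nabla_coeff_nonzero[of q w] by (auto simp: f_def scale_by_def)
  \<comment> \<open>Where \<open>nabla_coeff\<close> is nonzero, length \<open>2 * n\<close> forces
    \<open>num_Y w = n\<close>, so the degree used in \<open>f\<close> is the exponent of
    \<open>t\<close>.\<close>
  have F: "Poly_Mapping.lookup (fps_nth ?F n) w = (if length w = 2 * n then f w else 0)" for n w
  proof (cases "length w = 2 * n \<and> nabla_coeff q w \<noteq> 0")
    case True
    then have "num_Y w = n" "n > 0"
      using nabla_coeff_nonzero[of q w] length_eq_height[of w] by auto
    then show ?thesis by (simp add: lookup_nabla f_def scale_by_def q_int)
  next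
    case False
    then show ?thesis by (cases "n = 0") (auto simp: lookup_nabla f_def scale_by_def)
  qed
  have power: "Poly_Mapping.lookup (fps_nth (q_shuffle_power q ?F k) n) w =
      (if length w = 2 * n then conv_power q f k w else 0)" for k
    by (rule lookup_q_shuffle_power[of ?F f, OF F f])
  have F0: "fps_nth ?F 0 = 0" by simp
  have "Poly_Mapping.lookup (fps_nth (q_shuffle_exp q ?F) n) w =
      (if length w = 2 * n then \<Sum>k\<le>n. conv_power q f k w / fact k else 0)"
    by (subst q_shuffle_exp_nth[OF F0]) (simp add: lookup_sum power del: fps_nth_Abs_fps)
  \<comment> \<open>Height 0 and length \<open>2 * n\<close> give \<open>num_Y w = n\<close>, within
    the range of the sum; at other heights both sides vanish.\<close>
  also have "\<dots> = (if length w = 2 * n then fused q (inverse z) z w else 0)"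
  proof (cases "length w = 2 * n \<and> height w = 0")
    case True
    then have "num_Y w \<le> n" using length_eq_height[of w] by simp
    from fused_eq_conv_exp[OF assms(1) z this] show ?thesis by (simp add: f_def)
  next
    case False
    have "conv_power q f k w = 0" if "height w \<noteq> 0" for k
      using conv_power_nonzero[of f q k w, OF f] that by blast
    moreover have "fused q (inverse z) z w = 0" if "height w \<noteq> 0"
      using walk_nonzero_height that by (fastforce simp: fused_def)
    ultimately show ?thesis using False by auto
  qed
  also have "\<dots> = Poly_Mapping.lookup (fps_nth (Delta_fps q m) n) w"
    by (simp add: Delta_fps_def lookup_Delta[OF assms(1)] z_def)
  finally show "Poly_Mapping.lookup (fps_nth (Delta_fps q m) n) w =
    Poly_Mapping.lookup (fps_nth (q_shuffle_exp q ?F) n) w" ..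
qed

end
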